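(* Let $n,p,q$ be positive integers with $n>1$, and let $Q=p+q$. Then \[ A_{p,q}(Q^n+1)=\begin{cases} Q^n+Q-2, & \text{if } p>1 \text{ and } q>1,\\ Q^n+Q-1, & \text{if } q>p=1 \text{ or } p>q=1,\\ Q^n+Q, & \text{if } p=q=1.\end{cases} \]
   Context: For positive integers $p,q$, let $\theta_{p,q}$ be the generalised Thue--Morse substitution on $\{0,1\}$, $\theta_{p,q}\colon 0\mapsto 0^p1^q,\ 1\mapsto 1^p0^q$ (extended to words by concatenation), and let $v=v_0v_1v_2\dots=\lim_{n\to\infty}\theta_{p,q}^n(0)\in\{0,1\}^{\mathbb{N}}$ be the generalised Thue--Morse word, indexed from $0$. For positive integers $d,L$, a monochromatic arithmetic progression of difference $d$ and length $L$ in $v$ means that there is $i\ge 0$ with $v_i=v_{i+d}=\dots=v_{i+(L-1)d}$. $A_{p,q}(d)$ denotes the maximum length $L$ of a monochromatic arithmetic progression of difference $d$ in $v$ (this maximum exists and is finite for every $d\geq 1$). *)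

theory Defs
  imports Complex_Main "HOL-Library.Z2" "HOL-Library.Sublist"
begin

text \<open>The alphabet is the two-element type \<open>bit\<close> with elements \<open>0\<close> and \<open>1\<close>; finite words are lists.\<close>

definition subst_letter :: "nat \<Rightarrow> nat \<Rightarrow> bit \<Rightarrow> bit list" where
  "subst_letter p q a =
     (if a = 0 then replicate p 0 @ replicate q 1 else replicate p 1 @ replicate q 0)"

definition tm_subst :: "nat \<Rightarrow> nat \<Rightarrow> bit list \<Rightarrow> bit list" where
  "tm_subst p q w = concat (map (subst_letter p q) w)"

text \<open>
  The word \<open>v\<close> is the letterwise limit of the words \<open>(tm_subst p q ^^ n) [0]\<close>. For positive
  \<open>p\<close> and \<open>q\<close> this limit exists, and each of these words is a prefix of it: see
  \<open>thue_morse_eq_nth\<close> and \<open>length_subst_funpow\<close>.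
\<close>

definition thue_morse :: "nat \<Rightarrow> nat \<Rightarrow> nat \<Rightarrow> bit" where
  "thue_morse p q k =
     (THE a. \<forall>\<^sub>F n in sequentially.
        k < length ((tm_subst p q ^^ n) [0]) \<and> (tm_subst p q ^^ n) [0] ! k = a)"

definition mono_AP :: "(nat \<Rightarrow> 'a) \<Rightarrow> nat \<Rightarrow> nat \<Rightarrow> bool" where
  "mono_AP v d L \<longleftrightarrow> (\<exists>i. \<forall>j<L. v (i + j * d) = v i)"

text \<open>\<open>Max\<close> is only meaningful when the set of lengths is finite.\<close>

definition max_AP_length :: "nat \<Rightarrow> nat \<Rightarrow> nat \<Rightarrow> nat" where
  "max_AP_length p q d = Max {L. L > 0 \<and> mono_AP (thue_morse p q) d L}"

lemma subst_append: "tm_subst p q (u @ w) = tm_subst p q u @ tm_subst p q w"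
  by (simp add: tm_subst_def)

lemma length_subst: "length (tm_subst p q w) = (p + q) * length w"
  by (induction w) (simp_all add: tm_subst_def subst_letter_def)

lemma length_subst_funpow: "length ((tm_subst p q ^^ n) [0]) = (p + q) ^ n"
  by (induction n) (simp_all add: length_subst)

lemma prefix_subst_funpow_Suc:
  assumes "p > 0"
  shows "prefix ((tm_subst p q ^^ n) [0]) ((tm_subst p q ^^ Suc n) [0])"
proof (induction n)
  case 0
  then show ?case
    using assms by (cases p) (simp_all add: tm_subst_def subst_letter_def)
next
  case (Suc n)
  then show ?case
    by (auto simp: prefix_def subst_append)
qed

lemma prefix_subst_funpow:
  assumes "p > 0" "m \<le> n"
  shows "prefix ((tm_subst p q ^^ m) [0]) ((tm_subst p q ^^ n) [0])"
  using assms(2)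
proof (induction n rule: dec_induct)
  case base
  show ?case by simp
next
  case (step n)
  then show ?case
    using prefix_subst_funpow_Suc[OF assms(1)] prefix_order.trans by blast
qed

lemma thue_morse_eq_nth:
  assumes "p > 0" "k < length ((tm_subst p q ^^ m) [0])"
  shows "thue_morse p q k = (tm_subst p q ^^ m) [0] ! k"
proof -
  let ?P = "\<lambda>a n. k < length ((tm_subst p q ^^ n) [0]) \<and> (tm_subst p q ^^ n) [0] ! k = a"
  have ev: "\<forall>\<^sub>F n in sequentially. ?P ((tm_subst p q ^^ m) [0] ! k) n"
    unfolding eventually_sequentially
  proof (intro exI allI impI)
    fix n assume "m \<le> n"
    then obtain u where "(tm_subst p q ^^ n) [0] = (tm_subst p q ^^ m) [0] @ u"
      using prefix_subst_funpow[OF assms(1)] unfolding prefix_def by blast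
    then show "?P ((tm_subst p q ^^ m) [0] ! k) n"
      using assms(2) by (simp add: nth_append)
  qed
  show ?thesis
    unfolding thue_morse_def
  proof (rule the_equality)
    show "\<forall>\<^sub>F n in sequentially. ?P ((tm_subst p q ^^ m) [0] ! k) n" by (rule ev)
  next
    fix a assume "\<forall>\<^sub>F n in sequentially. ?P a n"
    with ev have "\<forall>\<^sub>F n in sequentially. a = (tm_subst p q ^^ m) [0] ! k"
      by eventually_elim simp
    then show "a = (tm_subst p q ^^ m) [0] ! k"
      by simp
  qed
qed

end

theory Submission
  imports Defs
begin

text \<open>
  Put \<open>N = Q ^ n\<close>. Since \<open>v (N * x + y) = v x + v y\<close> for \<open>y < N\<close>, a monochromatic progression of
  difference \<open>N + 1\<close> compares \<open>v x\<close> with \<open>v y\<close> while \<open>x\<close> and \<open>y\<close> increase together; each time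
  \<open>y\<close> wraps around modulo \<open>N\<close>, \<open>x\<close> skips one position. Hence a window of \<open>v\<close> ending just
  before a position \<open>T - 1\<close> agrees, up to complement, with a suffix of \<open>v\<close> on \<open>{0..<N}\<close>, and a window
  starting at \<open>T\<close> agrees with a prefix. A constant run of length \<open>Q\<close> occurs in \<open>v\<close> only at
  positions congruent to \<open>p\<close> modulo \<open>Q\<close>, so a long agreement on the left forces \<open>Q dvd T - 1\<close> and
  one on the right forces \<open>Q dvd T\<close>; in a progression of more than \<open>N + Q - 2\<close> terms one of the two
  is long. As both cannot be divisible by \<open>Q\<close>, only one side is aligned with the blocks, and the
  other side is then off by one, which allows at most \<open>max 1 (p - 1)\<close> further terms on the right or
  \<open>max 1 (q - 1)\<close> on the left. A complete aligned window \<open>{0..<N}\<close> extended on both sides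
  attains the bound. For \<open>p = q = 1\<close> the off-by-one agreement can have two terms, but
  not next to a complete window.
\<close>

section \<open>Arithmetic recursion for the word\<close>

lemma nth_tm_subst:
  assumes "m < length w" "r < p + q"
  shows "tm_subst p q w ! ((p + q) * m + r) = subst_letter p q (w ! m) ! r"
  using assms(1)
proof (induction w arbitrary: m)
  case Nil
  then show ?case by simp
next
  case (Cons a w)
  have len: "length (subst_letter p q a) = p + q"
    by (simp add: subst_letter_def)
  have eq: "tm_subst p q (a # w) = subst_letter p q a @ tm_subst p q w"
    by (simp add: tm_subst_def)
  show ?case
  proof (cases m)
    case 0
    then show ?thesis using len assms(2) by (simp add: eq nth_append)
  next
    case (Suc m')
    have "(p + q) * m + r = length (subst_letter p q a) + ((p + q) * m' + r)"
      by (simp add: Suc len)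
    then have "tm_subst p q (a # w) ! ((p + q) * m + r) = tm_subst p q w ! ((p + q) * m' + r)"
      by (metis eq nth_append_length_plus)
    then show ?thesis using Cons Suc by simp
  qed
qed

lemma thue_morse_0:
  assumes "p > 0"
  shows "thue_morse p q 0 = 0"
  using thue_morse_eq_nth[OF assms, where k = 0 and m = 0] by simp

text \<open>Position \<open>m\<close> lies inside the word of level \<open>m\<close>, as its length
  \<open>(p + q) ^ m\<close> exceeds \<open>m\<close>; one more substitution then covers position
  \<open>(p + q) * m + r\<close>.\<close>

lemma thue_morse_rec:
  assumes "p > 0" "q > 0" "r < p + q"
  shows "thue_morse p q ((p + q) * m + r) = subst_letter p q (thue_morse p q m) ! r"
proof -
  have len: "length ((tm_subst p q ^^ m) [0]) > m" (is "length ?w > m")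
    using assms less_le_trans[OF less_exp power_mono[of 2 "p + q" m]]
    by (simp add: length_subst_funpow)
  have "(p + q) * m + r < (p + q) * Suc m"
    using assms(3) by simp
  also have "\<dots> \<le> length ((tm_subst p q ^^ Suc m) [0])"
    using mult_le_mono2[OF Suc_leI[OF len], of "p + q"] by (simp add: length_subst)
  finally have "thue_morse p q ((p + q) * m + r) = (tm_subst p q ^^ Suc m) [0] ! ((p + q) * m + r)"
    using thue_morse_eq_nth[OF assms(1)] by blast
  then show ?thesis
    using nth_tm_subst[OF len assms(3)] thue_morse_eq_nth[OF assms(1) len] by simp
qed

lemma mono_AP_mono: "mono_AP v d L \<Longrightarrow> L' \<le> L \<Longrightarrow> mono_AP v d L'"
  unfolding mono_AP_def by (meson order_less_le_trans)

text \<open>Letters become Booleans, \<open>True\<close> for 1, so that complementing is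
  \<open>\<noteq>\<close>. In \<open>v_rec\<close> the condition \<open>p \<le> r\<close> marks the
  second part of a block, which carries the complement of the generating letter.\<close>

locale thue_morse_word =
  fixes p q Q :: nat and v :: "nat \<Rightarrow> bool"
  assumes p_pos: "p > 0" and q_pos: "q > 0" and Q_eq: "Q = p + q"
    and v_0: "\<not> v 0"
    and v_rec: "r < Q \<Longrightarrow> v (Q * m + r) \<longleftrightarrow> v m \<noteq> (p \<le> r)"
begin

lemma v_less: "r < Q \<Longrightarrow> v r \<longleftrightarrow> p \<le> r"
  using v_rec[of r 0] v_0 by simp

text \<open>Induction peels off the last base-\<open>Q\<close> digit of \<open>r\<close>, which acts
  through \<open>v_rec\<close> in the same way on both sides.\<close>

lemma v_pow: "r < Q ^ n \<Longrightarrow> v (Q ^ n * m + r) \<longleftrightarrow> v m \<noteq> v r"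
proof (induction n arbitrary: r)
  case 0
  then show ?case by (simp add: v_0)
next
  case (Suc n)
  have Q: "Q > 0" using p_pos Q_eq by simp
  have lt: "r div Q < Q ^ n" using Suc.prems Q by (simp add: less_mult_imp_div_less mult.commute)
  have "Q ^ Suc n * m + r = Q * (Q ^ n * m + r div Q) + r mod Q"
    by (simp add: algebra_simps)
  then have "v (Q ^ Suc n * m + r) \<longleftrightarrow> v (Q ^ n * m + r div Q) \<noteq> (p \<le> r mod Q)"
    using v_rec[of "r mod Q"] Q by simp
  moreover have "v r \<longleftrightarrow> v (r div Q) \<noteq> (p \<le> r mod Q)"
    using v_rec[of "r mod Q" "r div Q"] Q by simp
  ultimately show ?case using Suc.IH[OF lt] by auto
qed

section \<open>Long runs and synchronisation with the blocks\<close>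

text \<open>The \<open>q\<close> complemented letters closing block \<open>m\<close> equal the
  \<open>p\<close> letters opening block \<open>Suc m\<close>.\<close>

lemma v_block_run:
  assumes "v m \<noteq> v (Suc m)" "j < Q"
  shows "v (Q * m + p + j) \<longleftrightarrow> v (Suc m)"
proof (cases "j < q")
  case True
  then show ?thesis using v_rec[of "p + j" m] assms Q_eq by (simp add: add.assoc)
next
  case False
  then have eq: "Q * m + p + j = Q * Suc m + (j - q)" using Q_eq by simp
  have "j - q < p" using False assms(2) Q_eq by simp
  then show ?thesis unfolding eq using v_rec[of "j - q" "Suc m"] Q_eq by simp
qed

text \<open>In every block the letter changes from offset \<open>p - 1\<close> to offset
  \<open>p\<close>. A window of length \<open>Q\<close> avoids containing such a pair only if it
  starts at offset \<open>p\<close>.\<close>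

lemma v_run_mod:
  assumes "\<And>j. j < Q \<Longrightarrow> v (s + j) \<longleftrightarrow> c"
  shows "s mod Q = p"
proof (rule ccontr)
  assume ne: "s mod Q \<noteq> p"
  define t r where "t = s div Q" and "r = s mod Q"
  have s: "s = Q * t + r" by (simp add: t_def r_def)
  have r: "r < Q" "r \<noteq> p" using ne Q_eq p_pos by (auto simp: r_def)
  \<comment> \<open>The first block whose offset \<open>p - 1\<close> is not before
    \<open>s\<close>.\<close>
  define m where "m = (if r < p then t else Suc t)"
  define j where "j = Q * m + p - 1 - s"
  have j: "s + j = Q * m + (p - 1)" "s + Suc j = Q * m + p" "Suc j < Q"
    using s r p_pos q_pos Q_eq unfolding j_def m_def by (cases "r < p"; simp)+
  show False
    using assms[of j] assms[of "Suc j"] v_rec[of "p - 1" m] v_rec[of p m] j p_pos q_pos Q_eq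
    by auto
qed

text \<open>The change between \<open>p - 1\<close> and \<open>p\<close> yields a run of length
  \<open>Q\<close> ending exactly at the end of the first \<open>p * Q + p\<close> letters. Its copy
  in the window is constant too, so \<open>v_run_mod\<close> locates it.\<close>

lemma prefix_sync:
  assumes "\<And>k. k < p * Q + p \<Longrightarrow> (v (T + k) \<noteq> v k) \<longleftrightarrow> c"
  shows "Q dvd T"
proof -
  have ne: "v (p - 1) \<noteq> v (Suc (p - 1))"
    using v_less p_pos q_pos Q_eq by auto
  have "v (T + (Q * (p - 1) + p) + j) \<longleftrightarrow> (v p \<noteq> c)" if "j < Q" for j
  proof -
    have "Q * (p - 1) + Q = Q * p" using p_pos by (cases p) auto
    then have "Q * (p - 1) + p + j < p * Q + p" using that by (simp add: mult.commute)
    from assms[OF this] v_block_run[OF ne that] show ?thesis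
      using p_pos by (auto simp: add.assoc)
  qed
  then have "(T + (Q * (p - 1) + p)) mod Q = p" by (rule v_run_mod)
  then have "(T + p) mod Q = p mod Q"
    using q_pos Q_eq by (metis add.assoc add.commute less_add_same_cancel1 mod_less mod_mult_self2)
  then show ?thesis
    by (metis add_diff_cancel_right' mod_eq_dvd_iff_nat le_add2)
qed

text \<open>Mirror image of \<open>prefix_sync\<close>, with a run that starts
  \<open>q * Q + q\<close> letters before \<open>Q ^ n\<close>.\<close>

lemma suffix_sync:
  assumes n: "n > 1" and A: "q * Q + q \<le> A" "A \<le> Q ^ n"
    and pre: "\<And>j. j < A \<Longrightarrow> (v (S + j) \<noteq> v (Q ^ n - A + j)) \<longleftrightarrow> c"
  shows "Q dvd S + A"
proof -
  obtain k where k: "n = Suc (Suc k)" using n less_iff_Suc_add[of 1 n] by auto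
  define R where "R = Q ^ k - 1"
  have "Q > 0" using p_pos Q_eq by simp
  then have R: "Q ^ k = Suc R" by (simp add: R_def)
  \<comment> \<open>The end of the first part of the last block below \<open>Q ^ (n - 1)\<close>;
    the letter changes right after it.\<close>
  define m where "m = Q * R + (p - 1)"
  have N: "Q ^ n = Q * m + p + q * Q + q"
    using k R p_pos Q_eq unfolding m_def by (cases p) (auto simp: algebra_simps)
  have ne: "v m \<noteq> v (Suc m)"
    using v_rec[of "p - 1" R] v_rec[of p R] p_pos q_pos Q_eq unfolding m_def by auto
  have "v (S + A - (q * Q + q) + j) \<longleftrightarrow> (v (Suc m) \<noteq> c)" if "j < Q" for j
  proof -
    let ?i = "A - (q * Q + q) + j"
    have "Q \<le> q * Q" using q_pos by simp
    then have "?i < A" using that A q_pos by linarith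
    moreover have "Q ^ n - A + ?i = Q * m + p + j" using N A by linarith
    ultimately have "(v (S + ?i) \<noteq> v (Q * m + p + j)) \<longleftrightarrow> c" using pre[of ?i] by metis
    then show ?thesis using v_block_run[OF ne that] A by (auto simp: add.assoc)
  qed
  then have "(S + A - (q * Q + q)) mod Q = p" by (rule v_run_mod)
  moreover have "S + A = (S + A - (q * Q + q)) + q + q * Q" using A by simp
  ultimately have "(S + A) mod Q = (p + q) mod Q"
    by (metis mod_add_left_eq mod_mult_self1)
  then show ?thesis using Q_eq by (simp add: mod_eq_0_iff_dvd)
qed

section \<open>Agreement shifted by one position\<close>

text \<open>The window starts at offset 1 of a block, so for \<open>p > 1\<close> its letter changes
  at index \<open>p - 1\<close>, one index before the prefix does. For \<open>p = 1\<close> and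
  \<open>q > 1\<close> the prefix changes at index 1 while the window does not. For
  \<open>p = q = 1\<close> the contradiction needs three terms.\<close>

lemma shifted_prefix_bound:
  assumes "Q dvd U" and post: "\<And>k. k < C \<Longrightarrow> (v (U + 1 + k) \<noteq> v k) \<longleftrightarrow> c"
  shows "C \<le> (if Q = 2 then 2 else max 1 (p - 1))"
proof (rule ccontr)
  assume "\<not> ?thesis"
  then have C: "C > (if Q = 2 then 2 else max 1 (p - 1))" by simp
  obtain m where U: "U = Q * m" using assms(1) by blast
  consider "p > 1" | "p = 1" "q > 1" | "p = 1" "q = 1" using p_pos q_pos by linarith
  then show False
  proof cases
    case 1
    then have "v (U + 1 + 0) \<longleftrightarrow> v m" "v (U + 1 + (p - 1)) \<longleftrightarrow> \<not> v m" "\<not> v (p - 1)"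
      using v_rec[of 1 m] v_rec[of p m] v_less[of "p - 1"] U Q_eq q_pos by auto
    then show False using post[of 0] post[of "p - 1"] C v_0 1 Q_eq q_pos by (auto split: if_splits)
  next
    case 2
    then show False using post[of 0] post[of 1] C v_0 v_rec[of 1 m] v_rec[of 2 m] v_less[of 1] U Q_eq
      by auto
  next
    case 3
    then have "Q = 2" using Q_eq by simp
    then show False
      using post[of 0] post[of 1] post[of 2] C v_0 v_rec[of 1 m] v_rec[of 0 "Suc m"]
        v_rec[of 1 "Suc m"] v_less[of 1] v_rec[of 0 1] U 3
      by (auto simp: numeral_eq_Suc)
  qed
qed

text \<open>The last \<open>Q\<close> letters below \<open>Q ^ n\<close> form a single block;
  \<open>k\<close> counts backwards, so \<open>k < q\<close> selects its complemented part.\<close>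

lemma v_near_pow:
  assumes "n > 0" "k < Q"
  shows "v (Q ^ n - 1 - k) \<longleftrightarrow> v (Q ^ (n - 1) - 1) \<noteq> (k < q)"
proof -
  have "Q > 0" using p_pos Q_eq by simp
  then obtain R where R: "Q ^ (n - 1) = Suc R" by (metis Suc_pred zero_less_power)
  have "Q ^ n = Q * Q ^ (n - 1)" using assms(1) by (cases n) auto
  then have "Q ^ n - 1 - k = Q * R + (Q - 1 - k)" using R assms(2) by simp
  then show ?thesis using v_rec[of "Q - 1 - k" R] R assms Q_eq by auto
qed

text \<open>Read backwards, the window starts at the last but one offset of a block and the suffix
  at the last one, so the argument for prefixes applies with \<open>q\<close> in place of
  \<open>p\<close>.\<close>

lemma shifted_suffix_bound:
  assumes n: "n > 1" and A: "A \<le> Q ^ n" and dvd: "Q dvd S + A + 1"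
    and pre: "\<And>j. j < A \<Longrightarrow> (v (S + j) \<noteq> v (Q ^ n - A + j)) \<longleftrightarrow> c"
  shows "A \<le> (if Q = 2 then 2 else max 1 (q - 1))"
proof (rule ccontr)
  assume "\<not> ?thesis"
  then have C: "A > (if Q = 2 then 2 else max 1 (q - 1))" by simp
  obtain m where m: "S + A + 1 = Q * m" using dvd by blast
  \<comment> \<open>Positivity excludes \<open>m = 0\<close>; the shifted \<open>m\<close> is the
    block in which the window ends.\<close>
  then obtain m where m: "S + A + 1 = Q * m + Q" by (cases m) auto
  have pre': "(v (S + A - 1 - k) \<noteq> v (Q ^ n - 1 - k)) \<longleftrightarrow> c" if "k < A" for k
    using pre[of "A - 1 - k"] that A by simp
  have vS: "v (S + A - 1 - k) \<longleftrightarrow> v m \<noteq> (p \<le> Q - 2 - k)" if "k + 2 \<le> Q" for k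
  proof -
    have "S + A - 1 - k = Q * m + (Q - 2 - k)" using m that by simp
    then show ?thesis using v_rec[of "Q - 2 - k" m] that by simp
  qed
  have vN: "v (Q ^ n - 1 - k) \<longleftrightarrow> v (Q ^ (n - 1) - 1) \<noteq> (k < q)" if "k < Q" for k
    using v_near_pow that n by simp
  consider "q > 1" | "q = 1" "p > 1" | "p = 1" "q = 1" using p_pos q_pos by linarith
  then show False
  proof cases
    case 1
    then show False
      using pre'[of 0] pre'[of "q - 1"] C vS[of 0] vS[of "q - 1"] vN[of 0] vN[of "q - 1"] Q_eq p_pos
      by (auto split: if_splits)
  next
    case 2
    then show False
      using pre'[of 0] pre'[of 1] C vS[of 0] vS[of 1] vN[of 0] vN[of 1] Q_eq
      by (auto split: if_splits)
  next
    case 3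
    then have Q: "Q = 2" using Q_eq by simp
    then have C: "A > 2" using C by simp
    then obtain m' where m': "m = Suc m'" using m Q by (cases m) auto
    have "S + A - 1 - 1 = Q * m' + 1" "S + A - 1 - 2 = Q * m' + 0" using m m' Q by auto
    then have *: "v (S + A - 1 - 1) \<longleftrightarrow> \<not> v m'" "v (S + A - 1 - 2) \<longleftrightarrow> v m'"
      using v_rec[of 1 m'] v_rec[of 0 m'] Q 3 by simp_all
    obtain k where k: "n = Suc (Suc k)" using n less_iff_Suc_add[of 1 n] by auto
    obtain R where R: "Q ^ k = Suc R" using Q by (metis Suc_pred zero_less_power pos2)
    have N: "Q ^ n - 1 - 1 = Q * (Q * R + 1) + 0" "Q ^ n - 1 - 2 = Q * (Q * R + 0) + 1"
      using k R Q by auto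
    \<comment> \<open>These two letters agree, whereas the corresponding window letters form one
      block and differ.\<close>
    have "v (Q ^ n - 1 - 1) = v (Q ^ n - 1 - 2)"
      unfolding N using v_rec[of 0 "Q * R + 1"] v_rec[of 1 "Q * R + 0"] v_rec[of 0 R] v_rec[of 1 R] Q 3 by simp
    then show False using pre'[of 1] pre'[of 2] * C by auto
  qed
qed

text \<open>For \<open>p = q = 1\<close>, equal neighbours \<open>v x = v (x + 1)\<close> force
  \<open>x\<close> to be odd. A second matching term on either side gives such a pair and makes
  \<open>m\<close> odd, which the halved middle window permits only for \<open>Q ^ n = 4\<close>;
  there a second equal pair appears at an adjacent position.\<close>

lemma no_binary_overlap:
  assumes Q: "Q = 2" and n: "n > 1" and A: "A \<le> 2"
    and pre: "\<And>j. j < A \<Longrightarrow> (v (S + j) \<noteq> v (Q ^ n - A + j)) \<longleftrightarrow> c"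
    and mid: "\<And>k. k < Q ^ n \<Longrightarrow> (v (S + A + 1 + k) \<noteq> v k) \<longleftrightarrow> c"
    and post: "\<And>k. k < C \<Longrightarrow> (v (S + A + 1 + Q ^ n + 1 + k) \<noteq> v k) \<longleftrightarrow> c"
    and dvd: "Q dvd S + A + 1"
  shows "A \<le> 1 \<and> C \<le> 1"
proof -
  have pq: "p = 1" "q = 1" using Q Q_eq p_pos q_pos by auto
  have ev: "v (2 * m) \<longleftrightarrow> v m" and od: "v (2 * m + 1) \<longleftrightarrow> \<not> v m" for m
    using v_rec[of 0 m] v_rec[of 1 m] Q pq by auto
  have evodd: "odd x" if "v x = v (x + 1)" for x
  proof
    assume "even x"
    then obtain y where "x = 2 * y" by blast
    then show False using that ev od by simp
  qed
  obtain m where m: "S + A + 1 = 2 * m" using dvd Q by blast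
  obtain k where k: "n = Suc (Suc k)" using n less_iff_Suc_add[of 1 n] by auto
  have N: "Q ^ n = 4 * 2 ^ k" using k Q by simp
  have small: "v 1" "v 2" "\<not> v 3"
    using od[of 0] ev[of 1] od[of 1] v_0 by auto
  have mid': "(v (m + x) \<noteq> v x) \<longleftrightarrow> c" if "x < 2 * 2 ^ k" for x
  proof -
    have "(v (2 * (m + x)) \<noteq> v (2 * x)) \<longleftrightarrow> c"
      using mid[of "2 * x"] that N unfolding m by (simp add: distrib_left)
    then show ?thesis by (simp only: ev)
  qed
  \<comment> \<open>Since \<open>v 1 = v 2\<close>, the letters at \<open>m + 1\<close> and
    \<open>m + 2\<close> agree; index 2 is in range once \<open>k > 0\<close>.\<close>
  have even: "even m" if "k > 0"
  proof -
    have "(2::nat) ^ 1 \<le> 2 ^ k" using that by (intro power_increasing) auto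
    then have "v (m + 1) = v (m + 1 + 1)" using mid'[of 1] mid'[of 2] small
      by (auto simp: numeral_eq_Suc)
    then show ?thesis using evodd by fastforce
  qed
  have v01: "c \<longleftrightarrow> v m" "v (m + 1) \<noteq> v m"
  proof -
    have "(0::nat) < 2 * 2 ^ k" "(1::nat) < 2 * 2 ^ k"
      using one_le_power[of "2::nat" k] by linarith+
    then show "c \<longleftrightarrow> v m" "v (m + 1) \<noteq> v m"
      using mid'[of 0] mid'[of 1] v_0 small by auto
  qed
  have "A \<le> 1"
  proof (rule ccontr)
    assume "\<not> A \<le> 1"
    then have A2: "A = 2" using A by simp
    then obtain l where l: "m = l + 2" using m by (cases m; cases "m - 1") auto
    have S: "S = 2 * l + 1" using m l A2 by simp
    have e: "Q ^ n - A = 2 * (2 * 2 ^ k - 1)" "Q ^ n - A + 1 = 2 * (2 * 2 ^ k - 1) + 1"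
      using N A2 by auto
    have 0: "(v (2 * l + 1) \<noteq> v (2 * (2 * 2 ^ k - 1))) \<longleftrightarrow> c"
      using pre[of 0] A2 S e by simp
    have 1: "(v (2 * (l + 1)) \<noteq> v (2 * (2 * 2 ^ k - 1) + 1)) \<longleftrightarrow> c"
      using pre[of 1] A2 S e by (simp del: One_nat_def)
    have "v l = v (l + 1)" using 0 1 unfolding od ev by auto
    then have "odd l" by (rule evodd)
    then have "odd m" using l by simp
    then have "k = 0" using even by blast
    then have "c \<longleftrightarrow> v (l + 1)" using 1 small unfolding od ev by auto
    then have "v (l + 1) = v (l + 1 + 1)" using v01 l by simp
    then show False using evodd \<open>odd l\<close> by fastforce
  qed
  moreover have "C \<le> 1"
  proof (rule ccontr)
    assume "\<not> C \<le> 1"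
    then have C: "C > 1" by simp
    let ?m = "m + 2 * 2 ^ k"
    have U: "S + A + 1 + Q ^ n + 1 = 2 * ?m + 1" using m N by simp
    have 0: "(v (2 * ?m + 1) \<noteq> v 0) \<longleftrightarrow> c" using post[of 0] C U by simp
    have "2 * ?m + 1 + 1 = 2 * (?m + 1)" by simp
    then have 1: "(v (2 * (?m + 1)) \<noteq> v 1) \<longleftrightarrow> c" using post[of 1] C U by metis
    have eq: "v ?m = v (?m + 1)" "c \<longleftrightarrow> \<not> v ?m" using 0 1 v_0 small unfolding ev od by auto
    then have "odd m" using evodd by fastforce
    then have "k = 0" using even by blast
    then have "v (m + 1) = v (m + 1 + 1)" using eq v01 by (auto simp: numeral_eq_Suc)
    then show False using evodd \<open>odd m\<close> by fastforce
  qed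
  ultimately show ?thesis by simp
qed

section \<open>Upper bound\<close>

lemma mono_AP_upper:
  assumes n: "n > 1"
  shows "\<not> mono_AP v (Q ^ n + 1) (Q ^ n + max 1 (p - 1) + max 1 (q - 1) + 1)"
proof
  let ?N = "Q ^ n"
  define a b where ab_def: "a = max 1 (p - 1)" "b = max 1 (q - 1)"
  let ?L = "?N + a + b + 1"
  assume "mono_AP v (?N + 1) (?N + max 1 (p - 1) + max 1 (q - 1) + 1)"
  then obtain i where i: "\<And>j. j < ?L \<Longrightarrow> v (i + j * (?N + 1)) = v i"
    unfolding mono_AP_def ab_def by blast
  define S where "S = i div ?N"
  \<comment> \<open>The number of terms before the residue modulo \<open>?N\<close> first wraps
    around.\<close>
  define A where "A = ?N - i mod ?N"
  have Q2: "Q \<ge> 2" using Q_eq p_pos q_pos by simp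
  then have lt: "i mod ?N < ?N" by simp
  then have A: "0 < A" "A \<le> ?N" "?N - A = i mod ?N" by (auto simp: A_def)
  have isplit: "i = ?N * S + (?N - A)" using A by (simp add: S_def)
  have "Q ^ 2 \<le> ?N" using n Q2 by (intro power_increasing) auto
  then have NQ: "Q * p + Q * q \<le> ?N" using Q_eq by (simp add: power2_eq_square algebra_simps)
  have "p \<le> Q * q" using Q_eq q_pos mult_le_mono[of p Q 1 q] by simp
  then have big: "p * Q + p \<le> ?N" using NQ by (simp add: mult.commute)
  have "a \<le> p" "b \<le> q" using p_pos q_pos by (auto simp: ab_def)
  moreover have "Q \<le> ?N" using Q2 n by (simp add: self_le_power)
  ultimately have ab: "a + b + 1 \<le> ?N + 1" using Q_eq by linarith
  have seg: "(v x \<noteq> v y) \<longleftrightarrow> v i" if "y < ?N" "j < ?L" "i + j * (?N + 1) = ?N * x + y" for x y j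
    using i[OF that(2)] v_pow[OF that(1), of x] that(3) by simp
  \<comment> \<open>The three windows lie before, between and after the wraps; each wrap adds 1 to
    the position \<open>x\<close>.\<close>
  have pre: "(v (S + j) \<noteq> v (?N - A + j)) \<longleftrightarrow> v i" if "j < A" for j
    using that A isplit by (intro seg[of _ j]) (auto simp: algebra_simps)
  have mid: "(v (S + A + 1 + k) \<noteq> v k) \<longleftrightarrow> v i" if "k < ?N" "A + k < ?L" for k
    using that A isplit by (intro seg[of _ "A + k"]) (auto simp: algebra_simps)
  have post: "(v (S + A + 1 + ?N + 1 + k) \<noteq> v k) \<longleftrightarrow> v i" if "k < ?N" "A + ?N + k < ?L" for k
    using that A isplit by (intro seg[of _ "A + ?N + k"]) (auto simp: algebra_simps)
  have QN: "Q dvd ?N" using n by (simp add: dvd_power)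
  have sum2: "a + b = 2" if "Q = 2" using that Q_eq p_pos q_pos by (auto simp: ab_def)
  show False
  proof (cases "A \<le> a + b")
    case True
    \<comment> \<open>The middle window is complete, hence aligned, and both neighbours are off by
      one; they have \<open>a + b + 1\<close> terms in total.\<close>
    define C where "C = a + b + 1 - A"
    have mid': "(v (S + A + 1 + k) \<noteq> v k) \<longleftrightarrow> v i" if "k < ?N" for k
      using mid that True by simp
    have post': "(v (S + A + 1 + ?N + 1 + k) \<noteq> v k) \<longleftrightarrow> v i" if "k < C" for k
    proof (rule post)
      show "k < ?N" "A + ?N + k < ?L" using that A ab unfolding C_def by linarith+
    qed
    have dvd: "Q dvd S + A + 1"
      by (rule prefix_sync[where c = "v i"], rule mid') (use big in auto)
    have "A \<le> (if Q = 2 then 2 else b)"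
      using shifted_suffix_bound[OF n A(2) dvd pre] by (auto simp: ab_def)
    moreover have "C \<le> (if Q = 2 then 2 else a)"
      using shifted_prefix_bound[OF dvd_add[OF dvd QN] post'] by (auto simp: ab_def)
    moreover have "A \<le> 1 \<and> C \<le> 1" if "Q = 2"
      using no_binary_overlap[OF that n _ pre mid' post' dvd] calculation that by simp
    ultimately show False using True sum2 by (auto simp: C_def split: if_splits)
  next
    case False
    define B where "B = ?L - A"
    have B: "B \<le> ?N" "A + B = ?L" using False A by (auto simp: B_def)
    have mid': "(v (S + A + 1 + k) \<noteq> v k) \<longleftrightarrow> v i" if "k < B" for k
      using mid that B by simp
    have Adv: "Q dvd S + A" if "q * Q + q \<le> A"
      using suffix_sync[OF n that A(2) pre] by auto
    have Bdv: "Q dvd S + A + 1" if "p * Q + p \<le> B"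
      by (rule prefix_sync[where c = "v i"], rule mid') (use that in auto)
    \<comment> \<open>Were both windows short, \<open>A + B\<close> would be at most
      \<open>?N + Q - 2\<close>, which is less than \<open>?L\<close>.\<close>
    have "Q - 2 \<le> a + b" using Q_eq by (auto simp: ab_def)
    then have "q * Q + q \<le> A \<or> p * Q + p \<le> B"
      using NQ B Q_eq unfolding mult.commute[of Q] by linarith
    moreover have "\<not> (q * Q + q \<le> A \<and> p * Q + p \<le> B)"
      using Adv Bdv Q2 by (metis dvd_add_right_iff nat_dvd_1_iff_1 numeral_le_one_iff semiring_norm(69))
    moreover have "B \<le> (if Q = 2 then 2 else a)" if "Q dvd S + A"
      using shifted_prefix_bound[OF that mid'] by (auto simp: ab_def)
    moreover have "A \<le> (if Q = 2 then 2 else b)" if "Q dvd S + A + 1"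
      using shifted_suffix_bound[OF n A(2) that pre] by (auto simp: ab_def)
    ultimately show False using Adv Bdv A B sum2 by (auto split: if_splits)
  qed
qed

section \<open>Construction of a longest progression\<close>

text \<open>The extra terms compare adjacent letters of \<open>v\<close>. On the left these agree
  for \<open>q > 1\<close> and differ for \<open>q = 1\<close>, and \<open>cm\<close> compensates
  for this; \<open>cp\<close> does the same on the right with \<open>p\<close>.\<close>

lemma mono_AP_lower:
  assumes n: "n > 1" and m: "m > 0"
    and cm: "v (m - 1) \<longleftrightarrow> v m \<noteq> (q = 1)" and cp: "v (m + 1) \<longleftrightarrow> v m \<noteq> (p = 1)"
  shows "mono_AP v (Q ^ n + 1) (Q ^ n + max 1 (p - 1) + max 1 (q - 1))"
proof -
  let ?N = "Q ^ n"
  define a b where "a = max 1 (p - 1)" and "b = max 1 (q - 1)"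
  have Q2: "Q \<ge> 2" using Q_eq p_pos q_pos by simp
  have "Q ^ 2 \<le> ?N" using n Q2 by (intro power_increasing) auto
  moreover have "2 * Q \<le> Q ^ 2" using Q2 by (simp add: power2_eq_square)
  ultimately have NQ: "2 * Q \<le> ?N" by linarith
  have ab: "a < Q" "b < Q" using Q_eq p_pos q_pos by (auto simp: a_def b_def)
  obtain l where l: "m = Suc l" using m by (cases m) auto
  \<comment> \<open>The residue starts \<open>b\<close> steps before its wrap, the quotient
    \<open>b + 1\<close> before \<open>?N * m\<close>, because the wrap skips
    \<open>?N * m - 1\<close>.\<close>
  define i where "i = ?N * (?N * m - b - 1) + (?N - b)"
  have Nm: "?N * m = ?N * l + ?N" using l by simp
  have step: "v (i + j * (?N + 1)) \<longleftrightarrow> v m" if j: "j < ?N + a + b" for j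
  proof -
    have split: "v (i + j * (?N + 1)) \<longleftrightarrow> v x \<noteq> v y"
      if "y < ?N" "i + j * (?N + 1) = ?N * x + y" for x y
      using that v_pow by simp
    have eq: "i + j * (?N + 1) = ?N * (?N * m - b - 1 + j) + (?N - b + j)"
      by (simp add: i_def algebra_simps)
    consider "j < b" | "b \<le> j" "j < b + ?N" | "b + ?N \<le> j" by linarith
    then show ?thesis
    proof cases
      case 1
      define k where "k = b - 1 - j"
      have k: "k < b" "k + 1 < Q" using 1 ab by (auto simp: k_def)
      have e: "?N * m - b - 1 + j = ?N * l + (?N - 1 - (k + 1))" "?N - b + j = ?N - 1 - k"
        using Nm 1 ab NQ unfolding k_def by linarith+
      have "v (i + j * (?N + 1)) \<longleftrightarrow> v (?N * l + (?N - 1 - (k + 1))) \<noteq> v (?N - 1 - k)"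
        using NQ Q2 eq unfolding e by (intro split) auto
      also have "v (?N * l + (?N - 1 - (k + 1))) \<longleftrightarrow> v l \<noteq> v (?N - 1 - (k + 1))"
        using NQ Q2 by (intro v_pow) auto
      finally show ?thesis
        using v_near_pow[of n k] v_near_pow[of n "k + 1"] n k cm l q_pos
        by (auto simp: a_def b_def max_def split: if_splits)
    next
      case 2
      define k where "k = j - b"
      have k: "k < ?N" using 2 by (auto simp: k_def)
      have bN: "b + 1 \<le> ?N * m" using Nm NQ ab by simp
      have "i + j * (?N + 1) = ?N * (?N * m + k) + k"
      proof -
        have "?N * m - b - 1 + j + 1 = ?N * m + k" "?N - b + j = ?N + k"
          using 2 bN ab NQ by (auto simp: k_def)
        then show ?thesis unfolding eq by (metis add.assoc add.commute mult_Suc_right Suc_eq_plus1)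
      qed
      then have "v (i + j * (?N + 1)) \<longleftrightarrow> v (?N * m + k) \<noteq> v k"
        using k by (intro split)
      then show ?thesis using v_pow[OF k, of m] by auto
    next
      case 3
      \<comment> \<open>The second wrap skips \<open>?N * (m + 1)\<close>, so letter
        \<open>k + 1\<close> meets letter \<open>k\<close>.\<close>
      define k where "k = j - b - ?N"
      have k: "k < a" "k + 1 < Q" using 3 j ab by (auto simp: k_def)
      have bN: "b + 1 \<le> ?N * m" using Nm NQ ab by simp
      have "i + j * (?N + 1) = ?N * (?N * (m + 1) + (k + 1)) + k"
      proof -
        have "?N * m - b - 1 + j + 2 = ?N * (m + 1) + (k + 1)" "?N - b + j = ?N + ?N + k"
          using 3 bN ab NQ by (auto simp: k_def)
        moreover have "?N * x + (?N + ?N + k) = ?N * (x + 2) + k" for x by simp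
        ultimately show ?thesis unfolding eq by metis
      qed
      then have "v (i + j * (?N + 1)) \<longleftrightarrow> v (?N * (m + 1) + (k + 1)) \<noteq> v k"
        using k NQ by (intro split) auto
      also have "v (?N * (m + 1) + (k + 1)) \<longleftrightarrow> v (m + 1) \<noteq> v (k + 1)"
        using k NQ by (intro v_pow) auto
      finally show ?thesis
        using k cp v_less[of k] v_less[of "k + 1"] p_pos by (auto simp: a_def b_def max_def split: if_splits)
    qed
  qed
  show ?thesis
    unfolding mono_AP_def a_def[symmetric] b_def[symmetric]
  proof (intro exI allI impI)
    fix j assume "j < ?N + a + b"
    then show "v (i + j * (?N + 1)) = v i" using step[of j] step[of 0] by (simp add: b_def less_max_iff_disj)
  qed
qed

lemma mono_AP_attained:
  assumes n: "n > 1"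
  shows "mono_AP v (Q ^ n + 1) (Q ^ n + max 1 (p - 1) + max 1 (q - 1))"
proof -
  \<comment> \<open>The left neighbour must equal \<open>v m\<close> exactly if
    \<open>q > 1\<close>, the right one exactly if \<open>p > 1\<close>. Around the four witnesses
    the word reads 111, 110, 011 and 010.\<close>
  have "\<exists>m>0. (v (m - 1) \<longleftrightarrow> v m \<noteq> (q = 1)) \<and> (v (m + 1) \<longleftrightarrow> v m \<noteq> (p = 1))"
  proof -
    consider "q > 1" "p > 1" | "q > 1" "p = 1" | "q = 1" "p > 1" | "p = 1" "q = 1"
      using p_pos q_pos by linarith
    then show ?thesis
    proof cases
      case 1
      have "Q * p - 1 = Q * (p - 1) + (Q - 1)" using p_pos q_pos Q_eq by (cases p) auto
      then have "v (Q * p - 1)" "v (Q * p)" "v (Q * p + 1)"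
        using 1 v_rec[of "Q - 1" "p - 1"] v_rec[of 0 p] v_rec[of 1 p] v_less[of p] v_less[of "p - 1"] Q_eq
        by auto
      then show ?thesis using 1 p_pos Q_eq by (intro exI[of _ "Q * p"]) simp
    next
      case 2
      have "v (Q - 1)" "v Q" "\<not> v (Q + 1)"
        using 2 v_rec[of 0 1] v_rec[of 1 1] v_less[of 1] v_less[of "Q - 1"] Q_eq by auto
      then show ?thesis using 2 Q_eq by (intro exI[of _ Q]) simp
    next
      case 3
      let ?m = "Q * (p - 1) + p"
      have "p < Q" using Q_eq q_pos by simp
      have "?m + 1 = Q * p + 0" "?m - 1 = Q * (p - 1) + (p - 1)"
        using 3 Q_eq by (cases p; simp)+
      then have "\<not> v (?m - 1)" "v ?m" "v (?m + 1)"
        using 3 v_rec[of "p - 1" "p - 1"] v_rec[of p "p - 1"] v_rec[of 0 p] v_less[of p]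
          v_less[of "p - 1"] \<open>p < Q\<close>
        by auto
      then show ?thesis using 3 p_pos by (intro exI[of _ ?m]) simp
    next
      case 4
      then have "Q = 2" using Q_eq by simp
      then have "v 1" "v 2" "\<not> v 3" "v 4" "\<not> v 5"
        using 4 v_less[of 1] v_rec[of 0 1] v_rec[of 1 1] v_rec[of 0 2] v_rec[of 1 2] by auto
      then show ?thesis using 4 by (intro exI[of _ 4]) auto
    qed
  qed
  then show ?thesis using mono_AP_lower[OF n] by blast
qed

section \<open>Maximum length and transfer to the substitution word\<close>

lemma Max_mono_AP:
  assumes "n > 1"
  shows "Max {L. L > 0 \<and> mono_AP v (Q ^ n + 1) L} = Q ^ n + max 1 (p - 1) + max 1 (q - 1)"
    (is "Max ?X = ?M")
proof -
  have le: "L \<le> ?M" if "L \<in> ?X" for L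
  proof (rule ccontr)
    assume "\<not> L \<le> ?M"
    then have "?M + 1 \<le> L" by simp
    then show False using that mono_AP_upper[OF assms] mono_AP_mono by blast
  qed
  show ?thesis
  proof (rule Max_eqI)
    show "finite ?X" using le by (intro finite_subset[of ?X "{..?M}"]) auto
    show "?M \<in> ?X" using mono_AP_attained[OF assms] less_max_iff_disj[of 0 1 "p - 1"] by simp
  qed (rule le)
qed

end

lemma thue_morse_word_thue_morse:
  assumes "p > 0" "q > 0"
  shows "thue_morse_word p q (p + q) (\<lambda>k. thue_morse p q k = 1)"
proof
  show "(thue_morse p q ((p + q) * m + r) = 1) \<longleftrightarrow> (thue_morse p q m = 1) \<noteq> (p \<le> r)"
    if "r < p + q" for r m
    using that assms by (auto simp: thue_morse_rec subst_letter_def nth_append)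
qed (use assms in \<open>auto simp: thue_morse_0\<close>)

lemma mono_AP_thue_morse_iff:
  "mono_AP (thue_morse p q) d L \<longleftrightarrow> mono_AP (\<lambda>k. thue_morse p q k = 1) d L"
proof -
  have "a = b \<longleftrightarrow> (a = 1) = (b = 1)" for a b :: bit
    by (cases a; cases b) auto
  from this[of "thue_morse p q _" "thue_morse p q _"] show ?thesis
    by (simp add: mono_AP_def)
qed

theorem proposition27:
  fixes n p q Q :: nat
  assumes "p > 0" and "q > 0" and "n > 1" and "Q = p + q"
  shows "(p > 1 \<and> q > 1 \<longrightarrow> max_AP_length p q (Q ^ n + 1) = Q ^ n + Q - 2) \<and>
    ((q > p \<and> p = 1) \<or> (p > q \<and> q = 1) \<longrightarrow> max_AP_length p q (Q ^ n + 1) = Q ^ n + Q - 1) \<and>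
    (p = 1 \<and> q = 1 \<longrightarrow> max_AP_length p q (Q ^ n + 1) = Q ^ n + Q)"
proof -
  interpret thue_morse_word p q Q "\<lambda>k. thue_morse p q k = 1"
    using thue_morse_word_thue_morse assms by simp
  have "max_AP_length p q (Q ^ n + 1) = Q ^ n + max 1 (p - 1) + max 1 (q - 1)"
    unfolding max_AP_length_def mono_AP_thue_morse_iff by (rule Max_mono_AP[OF assms(3)])
  \<comment> \<open>\<open>max 1 (p - 1)\<close> is \<open>p - 1\<close> for \<open>p > 1\<close>
    and \<open>p\<close> for \<open>p = 1\<close>, and likewise for \<open>q\<close>; so each
    parameter greater than 1 lowers \<open>Q ^ n + Q\<close> by one.\<close>
  then show ?thesis using assms by (auto simp: max_def)
qed

end
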